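(* Let $N$ be a positive integer, let $A^{(i)}\in\mathbb{R}^{I_i\times I_i}$ for $i=1,2,\ldots,N$, and let $$\mathcal{A}=I-A^{(N)}\otimes\cdots\otimes A^{(2)}\otimes A^{(1)},$$ where $I$ is the identity matrix of order $I_1I_2\cdots I_N$. Assume that $\mathcal{A}$ is invertible and that $\prod_{i=1}^N\sigma_{\min}(A^{(i)})>1$. Then $$\mathrm{cond}(\mathcal{A})\le\left(\frac{\prod_{i=1}^N\sigma_{\min}(A^{(i)})}{\prod_{i=1}^N\sigma_{\min}(A^{(i)})-1}\right)\left(1+\prod_{i=1}^N\|A^{(i)}\|_2\right).$$
   Context: $\otimes$ is the Kronecker product; $\|\cdot\|_2$ is the matrix $2$-norm (spectral norm); $\sigma_{\min}(A)$ is the smallest singular value of $A$. For an invertible matrix $A$, $\mathrm{cond}(A)=\|A\|_2\|A^{-1}\|_2$. The matrix $\mathcal{A}$ is the coefficient matrix of the linear system equivalent (under vectorization) to the Stein tensor equation $\mathscr{X}-\mathscr{X}\times_1A^{(1)}\times_2A^{(2)}\cdots\times_NA^{(N)}=\mathscr{F}$. *)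

theory Defs
  imports
    "Jordan_Normal_Form.Gauss_Jordan_Elimination"
    "Jordan_Normal_Form.Char_Poly"
    "HOL-Analysis.L2_Norm"
begin

(* Block (i, j) of the product is A $$ (i, j) times B, so the index pair of B is the fast one. *)
definition kronecker :: "real mat \<Rightarrow> real mat \<Rightarrow> real mat" where
  "kronecker A B = mat (dim_row A * dim_row B) (dim_col A * dim_col B)
     (\<lambda>(i, j). A $$ (i div dim_row B, j div dim_col B) * B $$ (i mod dim_row B, j mod dim_col B))"

(* kronecker_chain A n is the product of A n, ..., A 2, A 1 in this order; the empty product
   is the 1 x 1 identity matrix, which is neutral for the Kronecker product. *)
primrec kronecker_chain :: "(nat \<Rightarrow> real mat) \<Rightarrow> nat \<Rightarrow> real mat" where
  "kronecker_chain A 0 = 1\<^sub>m 1"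
| "kronecker_chain A (Suc n) = kronecker (A (Suc n)) (kronecker_chain A n)"

lemma kronecker_one_right: "kronecker A (1\<^sub>m 1) = A"
  by (rule eq_matI) (simp_all add: kronecker_def)

lemma kronecker_carrier:
  assumes "A \<in> carrier_mat m n" and "B \<in> carrier_mat p q"
  shows "kronecker A B \<in> carrier_mat (m * p) (n * q)"
  using assms by (simp add: kronecker_def)

lemma kronecker_chain_carrier:
  assumes "\<And>i. i \<in> {1..n} \<Longrightarrow> A i \<in> carrier_mat (d i) (d i)"
  shows "kronecker_chain A n \<in> carrier_mat (\<Prod>i=1..n. d i) (\<Prod>i=1..n. d i)"
  using assms
proof (induction n)
  case 0
  show ?case by simp
next
  case (Suc n)
  have "kronecker_chain A n \<in> carrier_mat (\<Prod>i=1..n. d i) (\<Prod>i=1..n. d i)"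
    by (rule Suc.IH, rule Suc.prems) simp
  moreover have "A (Suc n) \<in> carrier_mat (d (Suc n)) (d (Suc n))"
    by (rule Suc.prems) simp
  ultimately have "kronecker (A (Suc n)) (kronecker_chain A n)
      \<in> carrier_mat (d (Suc n) * (\<Prod>i=1..n. d i)) (d (Suc n) * (\<Prod>i=1..n. d i))"
    by (rule kronecker_carrier[rotated])
  then show ?case by (simp add: prod.nat_ivl_Suc' mult.commute)
qed

definition vec_norm2 :: "real vec \<Rightarrow> real" where
  "vec_norm2 v = L2_set (\<lambda>i. v $ i) {..<dim_vec v}"

(* The supremum is over a nonempty set only if A has at least one column. *)
definition spectral_norm :: "real mat \<Rightarrow> real" where
  "spectral_norm A =
     (SUP v \<in> {v \<in> carrier_vec (dim_col A). v \<noteq> 0\<^sub>v (dim_col A)}.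
        vec_norm2 (A *\<^sub>v v) / vec_norm2 v)"

(* Intended for matrices with at least as many rows as columns: otherwise the eigenvalues of
   the Gram matrix include spurious zeros. *)
definition singular_values :: "real mat \<Rightarrow> real set" where
  "singular_values A = {sqrt k | k. eigenvalue (transpose_mat A * A) k}"

definition sigma_min :: "real mat \<Rightarrow> real" where
  "sigma_min A = Min (singular_values A)"

(* Meaningful for invertible A only; mat_inverse returns None on singular matrices. *)
definition cond_number :: "real mat \<Rightarrow> real" where
  "cond_number A = spectral_norm A * spectral_norm (the (mat_inverse A))"

end

theory Submission
  imports Defs
begin

text \<open>
  The factors satisfy \<open>sigma_min A * |v| \<le> |A v| \<le> spectral_norm A * |v|\<close>, and such bounds multiply
  under the Kronecker product. With \<open>K\<close> the Kronecker product and \<open>s > 1\<close> the product of the smallest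
  singular values, \<open>(s - 1) * |v| \<le> |K v| - |v| \<le> |(I - K) v|\<close> bounds the inverse of \<open>I - K\<close> by
  \<open>1 / (s - 1) \<le> s / (s - 1)\<close>, while the triangle inequality bounds \<open>I - K\<close> itself.

  That the lower bound \<open>sigma_min A\<close> is valid requires the infimum \<open>\<lambda>\<close> of the Rayleigh quotient
  to be an eigenvalue of the Gram matrix. If it were not, the form \<open>B = A\<^sup>T A - \<lambda> I\<close> would be
  positive semidefinite and invertible, hence coercive, which would raise the infimum.
\<close>

section \<open>Euclidean norm\<close>

lemma vec_norm2_nonneg [simp]: "0 \<le> vec_norm2 v"
  by (simp add: vec_norm2_def)

lemma vec_norm2_square_sum: "(vec_norm2 v)\<^sup>2 = (\<Sum>i<dim_vec v. (v $ i)\<^sup>2)"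
  by (simp add: vec_norm2_def L2_set_def sum_nonneg)

lemma vec_norm2_square: "(vec_norm2 v)\<^sup>2 = v \<bullet> v"
  unfolding vec_norm2_square_sum scalar_prod_def by (simp add: power2_eq_square atLeast0LessThan)

lemma vec_norm2_pos:
  assumes "v \<in> carrier_vec n" "v \<noteq> 0\<^sub>v n"
  shows "0 < vec_norm2 v"
proof -
  have "vec_norm2 v \<noteq> 0"
  proof
    assume "vec_norm2 v = 0"
    then have "\<forall>i<dim_vec v. v $ i = 0"
      by (simp add: vec_norm2_def L2_set_eq_0_iff Ball_def)
    then have "v = 0\<^sub>v n" using assms(1) by (intro eq_vecI) auto
    then show False using assms(2) by simp
  qed
  then show ?thesis using vec_norm2_nonneg[of v] by linarith
qed

lemma vec_norm2_zero [simp]: "vec_norm2 (0\<^sub>v n) = 0"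
  by (simp add: vec_norm2_def L2_set_eq_0_iff)

lemma vec_norm2_add_le:
  assumes "v \<in> carrier_vec n" "w \<in> carrier_vec n"
  shows "vec_norm2 (v + w) \<le> vec_norm2 v + vec_norm2 w"
proof -
  have "vec_norm2 (v + w) = L2_set (\<lambda>i. v $ i + w $ i) {..<n}"
    unfolding vec_norm2_def using assms by (intro L2_set_cong) auto
  then show ?thesis
    using L2_set_triangle_ineq[of "\<lambda>i. v $ i" "\<lambda>i. w $ i" "{..<n}"] assms
    by (simp add: vec_norm2_def)
qed

lemma vec_norm2_minus_commute:
  assumes "v \<in> carrier_vec n" "w \<in> carrier_vec n"
  shows "vec_norm2 (v - w) = vec_norm2 (w - v)"
proof -
  have "(vec_norm2 (v - w))\<^sup>2 = (vec_norm2 (w - v))\<^sup>2"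
    unfolding vec_norm2_square_sum using assms
    by (auto intro!: sum.cong simp: power2_commute)
  then show ?thesis by simp
qed

lemma vec_norm2_diff_le:
  assumes "v \<in> carrier_vec n" "w \<in> carrier_vec n"
  shows "vec_norm2 (v - w) \<le> vec_norm2 v + vec_norm2 w"
proof -
  have "(vec_norm2 (- w))\<^sup>2 = (vec_norm2 w)\<^sup>2"
    unfolding vec_norm2_square_sum by simp
  then have "vec_norm2 (- w) = vec_norm2 w" by simp
  then show ?thesis
    using vec_norm2_add_le[of v n "- w"] assms by (simp add: minus_add_uminus_vec)
qed

text \<open>Reverse triangle inequality, oriented for the case where the subtracted vector is the
  longer one: it is applied to \<open>v - K *\<^sub>v v\<close> with \<open>K\<close>
  expanding.\<close>

lemma vec_norm2_diff_ge:
  assumes "v \<in> carrier_vec n" "w \<in> carrier_vec n"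
  shows "vec_norm2 w - vec_norm2 v \<le> vec_norm2 (v - w)"
proof -
  have "w = v + (w - v)" using assms by (intro eq_vecI) auto
  then have "vec_norm2 w \<le> vec_norm2 v + vec_norm2 (w - v)"
    using vec_norm2_add_le[of v n "w - v"] assms by simp
  then show ?thesis using vec_norm2_minus_commute[OF assms] by simp
qed

text \<open>One-sided Cauchy-Schwarz, used to bound a quadratic form from above.\<close>

lemma scalar_prod_le_vec_norm2:
  assumes "v \<in> carrier_vec n" "w \<in> carrier_vec n"
  shows "v \<bullet> w \<le> vec_norm2 v * vec_norm2 w"
proof -
  have "v \<bullet> w \<le> (\<Sum>i<n. \<bar>v $ i\<bar> * \<bar>w $ i\<bar>)"
    using assms
    by (auto simp: scalar_prod_def atLeast0LessThan abs_mult[symmetric] intro!: sum_mono)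
  also have "\<dots> \<le> vec_norm2 v * vec_norm2 w"
    using L2_set_mult_ineq[of "\<lambda>i. v $ i" "\<lambda>i. w $ i" "{..<n}"] assms
    by (simp add: vec_norm2_def)
  finally show ?thesis .
qed

text \<open>A crude bound suffices, as it only has to exist: it makes the supremum in
  \<open>spectral_norm\<close> one of a bounded set, and it supplies the constants of the coercivity
  argument for the smallest eigenvalue.\<close>

lemma mult_mat_vec_bounded:
  fixes A :: "real mat"
  obtains C where "0 < C"
    "\<And>v. v \<in> carrier_vec (dim_col A) \<Longrightarrow> vec_norm2 (A *\<^sub>v v) \<le> C * vec_norm2 v"
proof
  \<comment> \<open>Cauchy-Schwarz on each row gives the sum of the row norms; the summand 1 keeps
    \<open>C\<close> strictly positive even for a zero matrix.\<close>
  define C where "C = (\<Sum>i<dim_row A. vec_norm2 (row A i)) + 1"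
  show "0 < C"
    using sum_nonneg[of "{..<dim_row A}" "\<lambda>i. vec_norm2 (row A i)"] by (simp add: C_def)
  fix v :: "real vec"
  assume v: "v \<in> carrier_vec (dim_col A)"
  have "\<bar>row A i \<bullet> v\<bar> \<le> vec_norm2 (row A i) * vec_norm2 v" for i
  proof -
    have "\<bar>row A i \<bullet> v\<bar> \<le> (\<Sum>j<dim_col A. \<bar>row A i $ j\<bar> * \<bar>v $ j\<bar>)"
      using v by (auto simp: scalar_prod_def atLeast0LessThan abs_mult[symmetric])
    also have "\<dots> \<le> vec_norm2 (row A i) * vec_norm2 v"
      using L2_set_mult_ineq[of "\<lambda>j. row A i $ j" "\<lambda>j. v $ j" "{..<dim_col A}"] v
      by (simp add: vec_norm2_def)
    finally show ?thesis .
  qed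
  then have "(\<Sum>i<dim_row A. \<bar>(A *\<^sub>v v) $ i\<bar>) \<le> (\<Sum>i<dim_row A. vec_norm2 (row A i) * vec_norm2 v)"
    by (intro sum_mono) auto
  then have "vec_norm2 (A *\<^sub>v v) \<le> (\<Sum>i<dim_row A. vec_norm2 (row A i)) * vec_norm2 v"
    using L2_set_le_sum_abs[of "\<lambda>i. (A *\<^sub>v v) $ i" "{..<dim_row A}"]
    by (simp add: vec_norm2_def sum_distrib_right)
  then show "vec_norm2 (A *\<^sub>v v) \<le> C * vec_norm2 v"
    by (simp add: C_def distrib_right add_increasing2)
qed

section \<open>Spectral norm\<close>

lemma nonzero_vec_exists:
  assumes "0 < n"
  shows "{v \<in> carrier_vec n. v \<noteq> 0\<^sub>v n} \<noteq> ({} :: real vec set)"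
proof -
  have "unit_vec n 0 \<noteq> (0\<^sub>v n :: real vec)"
    using assms by (metis index_unit_vec(1) index_zero_vec(1) zero_neq_one)
  then show ?thesis by (auto intro: exI[of _ "unit_vec n 0"])
qed

lemma mult_mat_vec_le_spectral_norm:
  assumes v: "v \<in> carrier_vec (dim_col A)"
  shows "vec_norm2 (A *\<^sub>v v) \<le> spectral_norm A * vec_norm2 v"
proof (cases "v = 0\<^sub>v (dim_col A)")
  case True
  obtain C where "vec_norm2 (A *\<^sub>v v) \<le> C * vec_norm2 v"
    using mult_mat_vec_bounded[of A] v by metis
  then show ?thesis using True by simp
next
  case False
  obtain C where C:
    "\<And>v. v \<in> carrier_vec (dim_col A) \<Longrightarrow> vec_norm2 (A *\<^sub>v v) \<le> C * vec_norm2 v"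
    using mult_mat_vec_bounded[of A] by metis
  have "bdd_above ((\<lambda>v. vec_norm2 (A *\<^sub>v v) / vec_norm2 v) `
      {v \<in> carrier_vec (dim_col A). v \<noteq> 0\<^sub>v (dim_col A)})"
    using C by (intro bdd_aboveI[of _ C]) (auto simp: pos_divide_le_eq vec_norm2_pos)
  then have "vec_norm2 (A *\<^sub>v v) / vec_norm2 v \<le> spectral_norm A"
    unfolding spectral_norm_def using v False by (intro cSUP_upper) auto
  then show ?thesis
    using vec_norm2_pos[OF v False] by (simp add: pos_divide_le_eq)
qed

lemma spectral_norm_le:
  assumes "0 < dim_col A"
    and "\<And>v. v \<in> carrier_vec (dim_col A) \<Longrightarrow> vec_norm2 (A *\<^sub>v v) \<le> c * vec_norm2 v"
  shows "spectral_norm A \<le> c"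
  unfolding spectral_norm_def
  using nonzero_vec_exists[OF assms(1)] assms(2)
  by (intro cSUP_least) (auto simp: pos_divide_le_eq vec_norm2_pos)

text \<open>A positive number of columns guarantees a nonzero test vector, so that the supremum is
  not taken over the empty set.\<close>

lemma spectral_norm_nonneg:
  assumes "0 < dim_col A"
  shows "0 \<le> spectral_norm A"
proof -
  obtain v :: "real vec" where v: "v \<in> carrier_vec (dim_col A)" "v \<noteq> 0\<^sub>v (dim_col A)"
    using nonzero_vec_exists[OF assms] by blast
  have "0 \<le> spectral_norm A * vec_norm2 v"
    using mult_mat_vec_le_spectral_norm[OF v(1)] vec_norm2_nonneg order_trans by blast
  then show ?thesis using vec_norm2_pos[OF v] by (simp add: zero_le_mult_iff)
qed

section \<open>Smallest singular value\<close>

lemma gram_scalar_prod: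
  fixes A :: "real mat"
  assumes "A \<in> carrier_mat m n" "x \<in> carrier_vec n" "y \<in> carrier_vec n"
  shows "((transpose_mat A * A) *\<^sub>v x) \<bullet> y = (A *\<^sub>v x) \<bullet> (A *\<^sub>v y)"
  using assms transpose_vec_mult_scalar[OF assms(1,3), of "A *\<^sub>v x"]
  by (simp add: assoc_mult_mat_vec[of _ n m _ n])

lemma char_matrix_mult_vec:
  fixes M :: "real mat"
  assumes "M \<in> carrier_mat n n" "x \<in> carrier_vec n"
  shows "char_matrix M l *\<^sub>v x = M *\<^sub>v x - l \<cdot>\<^sub>v x"
  unfolding char_matrix_def using assms
  by (intro eq_vecI) (auto simp: add_scalar_prod_distrib[of _ n])

lemma gram_char_matrix_scalar_prod:
  fixes A :: "real mat"
  assumes "A \<in> carrier_mat m n" "x \<in> carrier_vec n" "y \<in> carrier_vec n"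
  shows "(char_matrix (transpose_mat A * A) l *\<^sub>v x) \<bullet> y = (A *\<^sub>v x) \<bullet> (A *\<^sub>v y) - l * (x \<bullet> y)"
proof -
  have M: "transpose_mat A * A \<in> carrier_mat n n" using assms by simp
  have "(char_matrix (transpose_mat A * A) l *\<^sub>v x) \<bullet> y
      = ((transpose_mat A * A) *\<^sub>v x) \<bullet> y - (l \<cdot>\<^sub>v x) \<bullet> y"
    unfolding char_matrix_mult_vec[OF M assms(2)]
    by (rule minus_scalar_prod_distrib[of _ n]) (use M assms in auto)
  then show ?thesis unfolding gram_scalar_prod[OF assms] using assms by simp
qed

text \<open>For symmetric positive semidefinite \<open>B\<close> bounded by \<open>C\<close> this is
  the form inequality \<open>B^2 \<le> C B\<close>. It follows without square roots or
  diagonalisation by testing semidefiniteness at the gradient step \<open>x - t B x\<close>. Thus a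
  lower bound on \<open>B x\<close> becomes a lower bound on the form itself.\<close>

lemma psd_form_ge:
  fixes B :: "real mat"
  assumes B: "B \<in> carrier_mat n n"
    and sym: "\<And>x y. x \<in> carrier_vec n \<Longrightarrow> y \<in> carrier_vec n \<Longrightarrow> (B *\<^sub>v x) \<bullet> y = (B *\<^sub>v y) \<bullet> x"
    and psd: "\<And>x. x \<in> carrier_vec n \<Longrightarrow> 0 \<le> (B *\<^sub>v x) \<bullet> x"
    and C: "0 < C" "\<And>x. x \<in> carrier_vec n \<Longrightarrow> vec_norm2 (B *\<^sub>v x) \<le> C * vec_norm2 x"
    and x: "x \<in> carrier_vec n"
  shows "(vec_norm2 (B *\<^sub>v x))\<^sup>2 / C \<le> (B *\<^sub>v x) \<bullet> x"
proof -
  define y where "y = B *\<^sub>v x"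
  \<comment> \<open>This \<open>t\<close> minimises the quadratic bound obtained below for the form at \<open>x - t B x\<close>.\<close>
  define t where "t = 1 / C"
  have y: "y \<in> carrier_vec n" using B x by (simp add: y_def)
  have By: "B *\<^sub>v y \<in> carrier_vec n" using B y by simp
  have "(B *\<^sub>v y) \<bullet> y \<le> vec_norm2 (B *\<^sub>v y) * vec_norm2 y"
    by (rule scalar_prod_le_vec_norm2[OF By y])
  also have "\<dots> \<le> C * (vec_norm2 y)\<^sup>2"
    using mult_right_mono[OF C(2)[OF y], of "vec_norm2 y"] by (simp add: power2_eq_square mult.assoc)
  finally have ByyC: "(B *\<^sub>v y) \<bullet> y \<le> C * (vec_norm2 y)\<^sup>2" .
  have ty: "t \<cdot>\<^sub>v y \<in> carrier_vec n" using y by simp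
  have "0 \<le> (B *\<^sub>v (x - t \<cdot>\<^sub>v y)) \<bullet> (x - t \<cdot>\<^sub>v y)"
    using psd x ty by simp
  also have "B *\<^sub>v (x - t \<cdot>\<^sub>v y) = y - t \<cdot>\<^sub>v (B *\<^sub>v y)"
    using mult_minus_distrib_mat_vec[OF B x ty] mult_mat_vec[OF B y] by (simp add: y_def)
  also have "(y - t \<cdot>\<^sub>v (B *\<^sub>v y)) \<bullet> (x - t \<cdot>\<^sub>v y)
      = y \<bullet> x - t * (y \<bullet> y) - t * ((B *\<^sub>v y) \<bullet> x - t * ((B *\<^sub>v y) \<bullet> y))"
    using x y By ty
    by (simp add: minus_scalar_prod_distrib[of _ n] scalar_prod_minus_distrib[of _ n] algebra_simps)
  \<comment> \<open>Symmetry turns the second mixed term into the first one, \<open>|B x|^2\<close>,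
    so the two add up to the factor \<open>2 * t\<close>.\<close>
  also have "(B *\<^sub>v y) \<bullet> x = y \<bullet> y"
    using sym[OF x y] by (simp add: y_def)
  finally have "0 \<le> y \<bullet> x - 2 * t * (vec_norm2 y)\<^sup>2 + t * t * ((B *\<^sub>v y) \<bullet> y)"
    by (simp add: vec_norm2_square algebra_simps)
  also have "\<dots> \<le> y \<bullet> x - 2 * t * (vec_norm2 y)\<^sup>2 + t * t * (C * (vec_norm2 y)\<^sup>2)"
    using ByyC by (intro add_left_mono mult_left_mono) auto
  also have "\<dots> = y \<bullet> x - (vec_norm2 y)\<^sup>2 / C"
    using C(1) by (simp add: t_def field_simps)
  finally show ?thesis by (simp add: y_def)
qed

text \<open>A left inverse \<open>D\<close> is itself bounded, and
  \<open>x = D (B x)\<close>.\<close>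

lemma det_nonzero_bounded_below:
  fixes B :: "real mat"
  assumes B: "B \<in> carrier_mat n n" and det: "det B \<noteq> 0"
  obtains c where "0 < c" "\<And>x. x \<in> carrier_vec n \<Longrightarrow> vec_norm2 x \<le> c * vec_norm2 (B *\<^sub>v x)"
proof -
  obtain D where D: "D \<in> carrier_mat n n" "D * B = 1\<^sub>m n"
    using det_non_zero_imp_unit[OF B det, of "()"] by (auto simp: Units_def ring_mat_def)
  obtain c where c: "0 < c"
      "\<And>v. v \<in> carrier_vec (dim_col D) \<Longrightarrow> vec_norm2 (D *\<^sub>v v) \<le> c * vec_norm2 v"
    using mult_mat_vec_bounded[of D] by metis
  have "vec_norm2 x \<le> c * vec_norm2 (B *\<^sub>v x)" if x: "x \<in> carrier_vec n" for x
  proof -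
    have "D *\<^sub>v (B *\<^sub>v x) = x"
      using assoc_mult_mat_vec[OF D(1) B x] D(2) x by simp
    then show ?thesis using c(2)[of "B *\<^sub>v x"] B D x by simp
  qed
  with c(1) show thesis by (rule that)
qed

text \<open>The witness is the infimum of the Rayleigh quotient. Arguing by contradiction through
  the determinant replaces both compactness of the unit sphere and the spectral theorem: attainment
  of the infimum is never shown directly.\<close>

lemma min_gram_eigenvalue_exists:
  fixes A :: "real mat"
  assumes A: "A \<in> carrier_mat m n" and n: "0 < n"
  obtains l where "eigenvalue (transpose_mat A * A) l"
    "\<And>v. v \<in> carrier_vec n \<Longrightarrow> l * (vec_norm2 v)\<^sup>2 \<le> (vec_norm2 (A *\<^sub>v v))\<^sup>2"
proof
  define S where "S = {v \<in> carrier_vec n. v \<noteq> (0\<^sub>v n :: real vec)}"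
  define R where "R v = (vec_norm2 (A *\<^sub>v v))\<^sup>2 / (vec_norm2 v)\<^sup>2" for v
  define l where "l = (INF v\<in>S. R v)"
  have ne: "S \<noteq> {}" using nonzero_vec_exists[OF n] by (simp add: S_def)
  have pos: "0 < (vec_norm2 v)\<^sup>2" if "v \<in> S" for v
    using that vec_norm2_pos[of v n] by (simp add: S_def)
  have bdd: "bdd_below (R ` S)"
    by (rule bdd_belowI[of _ 0]) (auto simp: R_def)
  show lower: "l * (vec_norm2 v)\<^sup>2 \<le> (vec_norm2 (A *\<^sub>v v))\<^sup>2" if "v \<in> carrier_vec n" for v
  proof (cases "v = 0\<^sub>v n")
    case False
    then have v: "v \<in> S" using that by (simp add: S_def)
    have "l \<le> R v" unfolding l_def by (rule cINF_lower[OF bdd v])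
    then show ?thesis using pos[OF v] by (simp add: R_def pos_le_divide_eq)
  qed simp
  define M where "M = transpose_mat A * A"
  define B where "B = char_matrix M l"
  have M: "M \<in> carrier_mat n n" using A by (simp add: M_def)
  then have B: "B \<in> carrier_mat n n" by (simp add: B_def)
  have form: "(B *\<^sub>v x) \<bullet> y = (A *\<^sub>v x) \<bullet> (A *\<^sub>v y) - l * (x \<bullet> y)"
    if "x \<in> carrier_vec n" "y \<in> carrier_vec n" for x y
    unfolding B_def M_def by (rule gram_char_matrix_scalar_prod[OF A that])
  have form': "(B *\<^sub>v x) \<bullet> x = (vec_norm2 (A *\<^sub>v x))\<^sup>2 - l * (vec_norm2 x)\<^sup>2"
    if "x \<in> carrier_vec n" for x
    using form[OF that that] by (simp add: vec_norm2_square)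
  have sym: "(B *\<^sub>v x) \<bullet> y = (B *\<^sub>v y) \<bullet> x" if "x \<in> carrier_vec n" "y \<in> carrier_vec n" for x y
    using form[OF that] form[OF that(2,1)] that A
    by (simp add: comm_scalar_prod[of x n y] comm_scalar_prod[of "A *\<^sub>v x" m "A *\<^sub>v y"])
  have psd: "0 \<le> (B *\<^sub>v x) \<bullet> x" if "x \<in> carrier_vec n" for x
    using form'[OF that] lower[OF that] by simp
  have "det B = 0"
  proof (rule ccontr)
    assume "det B \<noteq> 0"
    then obtain c where c: "0 < c"
        "\<And>x. x \<in> carrier_vec n \<Longrightarrow> vec_norm2 x \<le> c * vec_norm2 (B *\<^sub>v x)"
      using det_nonzero_bounded_below[OF B] by blast
    obtain C where C: "0 < C"
        "\<And>x. x \<in> carrier_vec n \<Longrightarrow> vec_norm2 (B *\<^sub>v x) \<le> C * vec_norm2 x"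
      using mult_mat_vec_bounded[of B] B by auto
    \<comment> \<open>Invertibility gives \<open>|v|^2 \<le> c^2 |B v|^2\<close>, and
      \<open>psd_form_ge\<close> gives \<open>|B v|^2 / C \<le> (B v) \<bullet> v\<close>. Chained,
      they bound the form below by \<open>e |v|^2\<close>, so every Rayleigh quotient is at least
      \<open>l + e\<close>.\<close>
    define e where "e = 1 / (c\<^sup>2 * C)"
    have e: "0 < e" using c(1) C(1) by (simp add: e_def)
    have "l + e \<le> R v" if v: "v \<in> S" for v
    proof -
      have vc: "v \<in> carrier_vec n" using v by (simp add: S_def)
      have "(vec_norm2 v)\<^sup>2 \<le> c\<^sup>2 * (vec_norm2 (B *\<^sub>v v))\<^sup>2"
        using power_mono[OF c(2)[OF vc] vec_norm2_nonneg, of 2] by (simp add: power_mult_distrib)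
      then have "e * (vec_norm2 v)\<^sup>2 \<le> (vec_norm2 (B *\<^sub>v v))\<^sup>2 / C"
        using c(1) C(1) by (simp add: e_def field_simps)
      also have "\<dots> \<le> (B *\<^sub>v v) \<bullet> v"
        by (rule psd_form_ge[OF B sym psd C vc])
      finally have "(l + e) * (vec_norm2 v)\<^sup>2 \<le> (vec_norm2 (A *\<^sub>v v))\<^sup>2"
        using form'[OF vc] by (simp add: algebra_simps)
      then show ?thesis using pos[OF v] by (simp add: R_def pos_le_divide_eq)
    qed
    then have "l + e \<le> l" unfolding l_def by (intro cINF_greatest[OF ne])
    then show False using e by simp
  qed
  then show "eigenvalue (transpose_mat A * A) l"
    using eigenvalue_det[OF M] by (simp add: B_def M_def)
qed

text \<open>Eigenvalues are roots of the characteristic polynomial, which is monic and hence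
  nonzero. Finiteness gives the \<open>Min\<close> in \<open>sigma_min\<close> its usual
  properties.\<close>

lemma finite_eigenvalues:
  assumes "(M :: real mat) \<in> carrier_mat n n"
  shows "finite {k. eigenvalue M k}"
proof -
  have "char_poly M \<noteq> 0"
    using degree_monic_char_poly[OF assms] by auto
  then show ?thesis
    using poly_roots_finite eigenvalue_root_char_poly[OF assms] by simp
qed

text \<open>Pairing an eigenvector \<open>v\<close> with its image gives
  \<open>k |v|^2 = |A v|^2\<close>. The sign matters because \<open>sqrt\<close> is negative on
  negative reals.\<close>

lemma gram_eigenvalue_nonneg:
  assumes A: "A \<in> carrier_mat m n" and "eigenvalue (transpose_mat A * A) (k :: real)"
  shows "0 \<le> k"
proof -
  obtain v where v: "v \<in> carrier_vec n" "v \<noteq> 0\<^sub>v n" "(transpose_mat A * A) *\<^sub>v v = k \<cdot>\<^sub>v v"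
    using assms by (auto simp: eigenvalue_def eigenvector_def)
  have "k * (vec_norm2 v)\<^sup>2 = (vec_norm2 (A *\<^sub>v v))\<^sup>2"
    using gram_scalar_prod[OF A v(1) v(1)] v by (simp add: vec_norm2_square)
  then have "0 \<le> k * (vec_norm2 v)\<^sup>2" by simp
  then show ?thesis using vec_norm2_pos[OF v(1,2)] by (simp add: zero_le_mult_iff)
qed

lemma
  assumes A: "A \<in> carrier_mat m n" and n: "0 < n"
  shows sigma_min_nonneg: "0 \<le> sigma_min A"
    and sigma_min_mult_le:
      "v \<in> carrier_vec n \<Longrightarrow> sigma_min A * vec_norm2 v \<le> vec_norm2 (A *\<^sub>v v)"
proof -
  have M: "transpose_mat A * A \<in> carrier_mat n n" using A by simp
  have sv: "singular_values A = sqrt ` {k. eigenvalue (transpose_mat A * A) k}"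
    by (auto simp: singular_values_def)
  then have fin: "finite (singular_values A)"
    using finite_eigenvalues[OF M] by simp
  obtain l where l: "eigenvalue (transpose_mat A * A) l"
    "\<And>v. v \<in> carrier_vec n \<Longrightarrow> l * (vec_norm2 v)\<^sup>2 \<le> (vec_norm2 (A *\<^sub>v v))\<^sup>2"
    using min_gram_eigenvalue_exists[OF A n] by blast
  have mem: "sqrt l \<in> singular_values A" using l(1) by (simp add: sv)
  then show nonneg: "0 \<le> sigma_min A"
    unfolding sigma_min_def using fin gram_eigenvalue_nonneg[OF A]
    by (subst Min_ge_iff) (auto simp: sv)
  \<comment> \<open>Membership of \<open>sqrt l\<close> is enough: the minimum lies below it, so the
    bound by \<open>l\<close> passes to \<open>sigma_min A\<close>.\<close>
  have le: "sigma_min A \<le> sqrt l" unfolding sigma_min_def using fin mem by simp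
  assume v: "v \<in> carrier_vec n"
  have "sigma_min A * vec_norm2 v \<le> sqrt l * vec_norm2 v"
    by (rule mult_right_mono[OF le]) simp
  also have "\<dots> = sqrt (l * (vec_norm2 v)\<^sup>2)"
    by (simp add: real_sqrt_mult)
  also have "\<dots> \<le> sqrt ((vec_norm2 (A *\<^sub>v v))\<^sup>2)"
    using l(2)[OF v] by (rule real_sqrt_le_mono)
  finally show "sigma_min A * vec_norm2 v \<le> vec_norm2 (A *\<^sub>v v)" by simp
qed

section \<open>Kronecker products\<close>

text \<open>The substitution \<open>x = i * p + k\<close> follows the index layout of
  \<open>kronecker\<close>, where the second factor has the fast index.\<close>

lemma sum_div_mod_split:
  fixes f :: "nat \<Rightarrow> real"
  shows "(\<Sum>x<m * p. f x) = (\<Sum>i<m. \<Sum>k<p. f (i * p + k))"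
proof -
  have "(\<Sum>x<m * p. f x) = (\<Sum>i<m. sum f {i * p..<i * p + p})"
    by (simp add: sum.nat_group)
  moreover have "sum f {i * p..<i * p + p} = (\<Sum>k<p. f (i * p + k))" for i
    using sum.shift_bounds_nat_ivl[of f 0 "i * p" p] by (simp add: atLeast0LessThan add.commute)
  ultimately show ?thesis by simp
qed

lemma div_mod_less: "i < m \<Longrightarrow> k < p \<Longrightarrow> i * p + k < m * (p :: nat)"
proof -
  assume "i < m" "k < p"
  then have "i * p + k < (i + 1) * p" by simp
  also have "\<dots> \<le> m * p" using \<open>i < m\<close> by (intro mult_right_mono) auto
  finally show ?thesis .
qed

text \<open>
  Reading \<open>v\<close> as the matrix with rows \<open>V j\<close>, the Kronecker product first applies \<open>B\<close> to every row
  and then \<open>A\<close> to every column \<open>W k\<close> of the result.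
\<close>
lemma kronecker_mult_vec_norms:
  assumes A: "A \<in> carrier_mat m n" and B: "B \<in> carrier_mat p q" and v: "v \<in> carrier_vec (n * q)"
  obtains V W :: "nat \<Rightarrow> real vec"
  where "\<And>j. V j \<in> carrier_vec q" "\<And>k. W k \<in> carrier_vec n"
    and "(vec_norm2 v)\<^sup>2 = (\<Sum>j<n. (vec_norm2 (V j))\<^sup>2)"
    and "(\<Sum>k<p. (vec_norm2 (W k))\<^sup>2) = (\<Sum>j<n. (vec_norm2 (B *\<^sub>v V j))\<^sup>2)"
    and "(vec_norm2 (kronecker A B *\<^sub>v v))\<^sup>2 = (\<Sum>k<p. (vec_norm2 (A *\<^sub>v W k))\<^sup>2)"
proof
  define V where "V j = vec q (\<lambda>l. v $ (j * q + l))" for j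
  define W where "W k = vec n (\<lambda>j. (B *\<^sub>v V j) $ k)" for k
  show "V j \<in> carrier_vec q" for j by (simp add: V_def)
  show "W k \<in> carrier_vec n" for k by (simp add: W_def)
  show "(vec_norm2 v)\<^sup>2 = (\<Sum>j<n. (vec_norm2 (V j))\<^sup>2)"
    using v by (simp add: vec_norm2_square_sum sum_div_mod_split V_def)
  \<comment> \<open>The vectors \<open>B *\<^sub>v V j\<close> and the vectors \<open>W k\<close>
    list the same array of numbers, by one index or by the other; hence equal sums of
    squares.\<close>
  have "(\<Sum>k<p. (vec_norm2 (W k))\<^sup>2) = (\<Sum>k<p. \<Sum>j<n. ((B *\<^sub>v V j) $ k)\<^sup>2)"
    by (simp add: vec_norm2_square_sum W_def)
  also have "\<dots> = (\<Sum>j<n. \<Sum>k<p. ((B *\<^sub>v V j) $ k)\<^sup>2)"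
    by (rule sum.swap)
  also have "\<dots> = (\<Sum>j<n. (vec_norm2 (B *\<^sub>v V j))\<^sup>2)"
    using B by (simp add: vec_norm2_square_sum del: index_mult_mat_vec)
  finally show "(\<Sum>k<p. (vec_norm2 (W k))\<^sup>2) = (\<Sum>j<n. (vec_norm2 (B *\<^sub>v V j))\<^sup>2)" .
  have K: "kronecker A B \<in> carrier_mat (m * p) (n * q)" by (rule kronecker_carrier[OF A B])
  have entry: "(kronecker A B *\<^sub>v v) $ (i * p + k) = (A *\<^sub>v W k) $ i" if i: "i < m" and k: "k < p" for i k
  proof -
    have lt: "i * p + k < m * p" by (rule div_mod_less[OF i k])
    have "(kronecker A B *\<^sub>v v) $ (i * p + k)
        = (\<Sum>x<n * q. kronecker A B $$ (i * p + k, x) * v $ x)"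
      using K v lt by (simp add: scalar_prod_def atLeast0LessThan)
    also have "\<dots> = (\<Sum>j<n. \<Sum>l<q. kronecker A B $$ (i * p + k, j * q + l) * v $ (j * q + l))"
      by (rule sum_div_mod_split)
    \<comment> \<open>As \<open>k < p\<close> and \<open>l < q\<close>, \<open>div\<close> and
      \<open>mod\<close> recover the pairs \<open>(i, k)\<close> and \<open>(j, l)\<close> from the
      combined indices.\<close>
    also have "\<dots> = (\<Sum>j<n. \<Sum>l<q. A $$ (i, j) * B $$ (k, l) * v $ (j * q + l))"
      using A B lt k div_mod_less[of _ n _ q] by (intro sum.cong refl) (simp add: kronecker_def)
    also have "\<dots> = (\<Sum>j<n. A $$ (i, j) * (B *\<^sub>v V j) $ k)"
      using B k by (simp add: scalar_prod_def V_def atLeast0LessThan sum_distrib_left mult.assoc)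
    also have "\<dots> = (A *\<^sub>v W k) $ i"
      using A i by (simp add: scalar_prod_def W_def atLeast0LessThan del: index_mult_mat_vec)
        (simp add: scalar_prod_def atLeast0LessThan)
    finally show ?thesis .
  qed
  have "(vec_norm2 (kronecker A B *\<^sub>v v))\<^sup>2 = (\<Sum>i<m. \<Sum>k<p. ((kronecker A B *\<^sub>v v) $ (i * p + k))\<^sup>2)"
    using K by (simp add: vec_norm2_square_sum sum_div_mod_split del: index_mult_mat_vec)
  also have "\<dots> = (\<Sum>i<m. \<Sum>k<p. ((A *\<^sub>v W k) $ i)\<^sup>2)"
    by (simp add: entry del: index_mult_mat_vec)
  also have "\<dots> = (\<Sum>k<p. \<Sum>i<m. ((A *\<^sub>v W k) $ i)\<^sup>2)"
    by (rule sum.swap)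
  also have "\<dots> = (\<Sum>k<p. (vec_norm2 (A *\<^sub>v W k))\<^sup>2)"
    using A by (simp add: vec_norm2_square_sum del: index_mult_mat_vec)
  finally show "(vec_norm2 (kronecker A B *\<^sub>v v))\<^sup>2 = (\<Sum>k<p. (vec_norm2 (A *\<^sub>v W k))\<^sup>2)" .
qed

text \<open>Squared norms add over the pieces \<open>V j\<close> and \<open>W k\<close>, so the
  bound for \<open>B\<close> applies piecewise in the first stage and the one for \<open>A\<close>
  in the second.\<close>

lemma kronecker_mult_vec_le:
  assumes A: "A \<in> carrier_mat m n" and B: "B \<in> carrier_mat p q" and v: "v \<in> carrier_vec (n * q)"
    and nonneg: "0 \<le> a" "0 \<le> b"
    and a: "\<And>x. x \<in> carrier_vec n \<Longrightarrow> vec_norm2 (A *\<^sub>v x) \<le> a * vec_norm2 x"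
    and b: "\<And>x. x \<in> carrier_vec q \<Longrightarrow> vec_norm2 (B *\<^sub>v x) \<le> b * vec_norm2 x"
  shows "vec_norm2 (kronecker A B *\<^sub>v v) \<le> a * b * vec_norm2 v"
proof (rule kronecker_mult_vec_norms[OF A B v])
  fix V W :: "nat \<Rightarrow> real vec"
  assume V: "\<And>j. V j \<in> carrier_vec q" and W: "\<And>k. W k \<in> carrier_vec n"
    and v_eq: "(vec_norm2 v)\<^sup>2 = (\<Sum>j<n. (vec_norm2 (V j))\<^sup>2)"
    and W_eq: "(\<Sum>k<p. (vec_norm2 (W k))\<^sup>2) = (\<Sum>j<n. (vec_norm2 (B *\<^sub>v V j))\<^sup>2)"
    and K_eq: "(vec_norm2 (kronecker A B *\<^sub>v v))\<^sup>2 = (\<Sum>k<p. (vec_norm2 (A *\<^sub>v W k))\<^sup>2)"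
  have a2: "(vec_norm2 (A *\<^sub>v W k))\<^sup>2 \<le> a\<^sup>2 * (vec_norm2 (W k))\<^sup>2" for k
    using power_mono[OF a[OF W], of k 2] by (simp add: power_mult_distrib)
  have b2: "(vec_norm2 (B *\<^sub>v V j))\<^sup>2 \<le> b\<^sup>2 * (vec_norm2 (V j))\<^sup>2" for j
    using power_mono[OF b[OF V], of j 2] by (simp add: power_mult_distrib)
  have "(vec_norm2 (kronecker A B *\<^sub>v v))\<^sup>2 \<le> a\<^sup>2 * (\<Sum>j<n. (vec_norm2 (B *\<^sub>v V j))\<^sup>2)"
    using a2 unfolding K_eq W_eq[symmetric] sum_distrib_left by (intro sum_mono)
  also have "\<dots> \<le> a\<^sup>2 * (b\<^sup>2 * (vec_norm2 v)\<^sup>2)"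
    using b2 unfolding v_eq sum_distrib_left[of "b\<^sup>2"] by (intro mult_left_mono sum_mono) auto
  finally have "(vec_norm2 (kronecker A B *\<^sub>v v))\<^sup>2 \<le> (a * b * vec_norm2 v)\<^sup>2"
    by (simp add: power_mult_distrib mult.assoc)
  then show ?thesis by (rule power2_le_imp_le) (use nonneg in simp)
qed

text \<open>The same two stages with the inequalities reversed; here nonnegativity of
  \<open>a\<close> and \<open>b\<close> is what allows the hypotheses to be squared.\<close>

lemma kronecker_mult_vec_ge:
  assumes A: "A \<in> carrier_mat m n" and B: "B \<in> carrier_mat p q" and v: "v \<in> carrier_vec (n * q)"
    and nonneg: "0 \<le> a" "0 \<le> b"
    and a: "\<And>x. x \<in> carrier_vec n \<Longrightarrow> a * vec_norm2 x \<le> vec_norm2 (A *\<^sub>v x)"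
    and b: "\<And>x. x \<in> carrier_vec q \<Longrightarrow> b * vec_norm2 x \<le> vec_norm2 (B *\<^sub>v x)"
  shows "a * b * vec_norm2 v \<le> vec_norm2 (kronecker A B *\<^sub>v v)"
proof (rule kronecker_mult_vec_norms[OF A B v])
  fix V W :: "nat \<Rightarrow> real vec"
  assume V: "\<And>j. V j \<in> carrier_vec q" and W: "\<And>k. W k \<in> carrier_vec n"
    and v_eq: "(vec_norm2 v)\<^sup>2 = (\<Sum>j<n. (vec_norm2 (V j))\<^sup>2)"
    and W_eq: "(\<Sum>k<p. (vec_norm2 (W k))\<^sup>2) = (\<Sum>j<n. (vec_norm2 (B *\<^sub>v V j))\<^sup>2)"
    and K_eq: "(vec_norm2 (kronecker A B *\<^sub>v v))\<^sup>2 = (\<Sum>k<p. (vec_norm2 (A *\<^sub>v W k))\<^sup>2)"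
  have a2: "a\<^sup>2 * (vec_norm2 (W k))\<^sup>2 \<le> (vec_norm2 (A *\<^sub>v W k))\<^sup>2" for k
    using power_mono[OF a[OF W], of k 2] nonneg by (simp add: power_mult_distrib)
  have b2: "b\<^sup>2 * (vec_norm2 (V j))\<^sup>2 \<le> (vec_norm2 (B *\<^sub>v V j))\<^sup>2" for j
    using power_mono[OF b[OF V], of j 2] nonneg by (simp add: power_mult_distrib)
  have "a\<^sup>2 * (b\<^sup>2 * (vec_norm2 v)\<^sup>2) \<le> a\<^sup>2 * (\<Sum>j<n. (vec_norm2 (B *\<^sub>v V j))\<^sup>2)"
    using b2 unfolding v_eq sum_distrib_left[of "b\<^sup>2"] by (intro mult_left_mono sum_mono) auto
  also have "\<dots> \<le> (vec_norm2 (kronecker A B *\<^sub>v v))\<^sup>2"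
    using a2 unfolding K_eq W_eq[symmetric] sum_distrib_left by (intro sum_mono)
  finally have "(a * b * vec_norm2 v)\<^sup>2 \<le> (vec_norm2 (kronecker A B *\<^sub>v v))\<^sup>2"
    by (simp add: power_mult_distrib mult.assoc)
  then show ?thesis by (rule power2_le_imp_le) simp
qed

text \<open>Induction on the number of factors, with \<open>v\<close> arbitrary because its
  dimension changes at each step. The base case is an equality, as the empty chain is the identity
  and empty products are 1.\<close>

lemma kronecker_chain_mult_vec_bounds:
  assumes "\<And>i. i \<in> {1..N} \<Longrightarrow> 1 \<le> d i"
    and "\<And>i. i \<in> {1..N} \<Longrightarrow> A i \<in> carrier_mat (d i) (d i)"
    and "v \<in> carrier_vec (\<Prod>i=1..N. d i)"
  shows "(\<Prod>i=1..N. sigma_min (A i)) * vec_norm2 v \<le> vec_norm2 (kronecker_chain A N *\<^sub>v v)"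
    and "vec_norm2 (kronecker_chain A N *\<^sub>v v) \<le> (\<Prod>i=1..N. spectral_norm (A i)) * vec_norm2 v"
  using assms
proof (induction N arbitrary: v)
  case 0
  { case 1 then show ?case by simp next case 2 then show ?case by simp }
next
  case (Suc N)
  define q where "q = (\<Prod>i=1..N. d i)"
  \<comment> \<open>Polymorphic, since it splits the dimensions in \<open>nat\<close> as well as the
    real bounds; the newest factor comes first, as in \<open>kronecker_chain\<close>.\<close>
  have split: "prod f {1..Suc N} = f (Suc N) * prod f {1..N}" for f :: "nat \<Rightarrow> 'b :: comm_monoid_mult"
    by (simp add: prod.nat_ivl_Suc' mult.commute)
  {
    case 1
    have A: "A (Suc N) \<in> carrier_mat (d (Suc N)) (d (Suc N))" and pos: "0 < d (Suc N)"
      using 1(1)[of "Suc N"] 1(2)[of "Suc N"] by auto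
    have B: "kronecker_chain A N \<in> carrier_mat q q"
      unfolding q_def using 1(2) by (intro kronecker_chain_carrier) auto
    have nonneg: "0 \<le> (\<Prod>i=1..N. sigma_min (A i))"
    proof (rule prod_nonneg)
      fix i assume "i \<in> {1..N}"
      then show "0 \<le> sigma_min (A i)"
        using 1(1)[of i] sigma_min_nonneg[OF 1(2)[of i]] by auto
    qed
    have v: "v \<in> carrier_vec (d (Suc N) * q)" using 1(3) unfolding split q_def .
    show ?case unfolding split kronecker_chain.simps
    proof (rule kronecker_mult_vec_ge[OF A B v _ nonneg])
      show "0 \<le> sigma_min (A (Suc N))" by (rule sigma_min_nonneg[OF A pos])
      show "sigma_min (A (Suc N)) * vec_norm2 x \<le> vec_norm2 (A (Suc N) *\<^sub>v x)"
        if "x \<in> carrier_vec (d (Suc N))" for x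
        by (rule sigma_min_mult_le[OF A pos that])
      show "(\<Prod>i=1..N. sigma_min (A i)) * vec_norm2 x \<le> vec_norm2 (kronecker_chain A N *\<^sub>v x)"
        if "x \<in> carrier_vec q" for x
        using Suc.IH(1)[of x] 1(1,2) that by (simp add: q_def)
    qed
  next
    case 2
    have A: "A (Suc N) \<in> carrier_mat (d (Suc N)) (d (Suc N))" and pos: "0 < d (Suc N)"
      using 2(1)[of "Suc N"] 2(2)[of "Suc N"] by auto
    have B: "kronecker_chain A N \<in> carrier_mat q q"
      unfolding q_def using 2(2) by (intro kronecker_chain_carrier) auto
    have nonneg: "0 \<le> (\<Prod>i=1..N. spectral_norm (A i))"
    proof (rule prod_nonneg)
      fix i assume "i \<in> {1..N}"
      then show "0 \<le> spectral_norm (A i)"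
        using 2(1)[of i] 2(2)[of i] spectral_norm_nonneg[of "A i"] by auto
    qed
    have v: "v \<in> carrier_vec (d (Suc N) * q)" using 2(3) unfolding split q_def .
    show ?case unfolding split kronecker_chain.simps
    proof (rule kronecker_mult_vec_le[OF A B v _ nonneg])
      show "0 \<le> spectral_norm (A (Suc N))" using A pos by (intro spectral_norm_nonneg) simp
      show "vec_norm2 (A (Suc N) *\<^sub>v x) \<le> spectral_norm (A (Suc N)) * vec_norm2 x"
        if "x \<in> carrier_vec (d (Suc N))" for x
        using A that by (intro mult_mat_vec_le_spectral_norm) simp
      show "vec_norm2 (kronecker_chain A N *\<^sub>v x) \<le> (\<Prod>i=1..N. spectral_norm (A i)) * vec_norm2 x"
        if "x \<in> carrier_vec q" for x
        using Suc.IH(2)[of x] 2(1,2) that by (simp add: q_def)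
    qed
  }
qed

section \<open>Condition number\<close>

text \<open>Links the predicate \<open>invertible_mat\<close> to the computed
  \<open>mat_inverse\<close> through the units of the matrix ring.\<close>

lemma invertible_mat_inverse:
  fixes M :: "real mat"
  assumes M: "M \<in> carrier_mat n n" and inv: "invertible_mat M"
  shows "the (mat_inverse M) \<in> carrier_mat n n" "M * the (mat_inverse M) = 1\<^sub>m n"
proof -
  obtain B where B: "M * B = 1\<^sub>m n" "B * M = 1\<^sub>m (dim_row B)"
    using inv M by (auto simp: invertible_mat_def inverts_mat_def)
  \<comment> \<open>The definition of \<open>invertible_mat\<close> does not fix the shape of
    \<open>B\<close>; it is read off from the two products being identity matrices.\<close>
  have "B \<in> carrier_mat n n"
  proof
    show "dim_col B = n" using arg_cong[OF B(1), of dim_col] by simp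
    show "dim_row B = n" using arg_cong[OF B(2), of dim_col] M by simp
  qed
  then have "M \<in> Units (ring_mat TYPE(real) n ())"
    using M B by (auto simp: Units_def ring_mat_def)
  then obtain D where "mat_inverse M = Some D"
    using mat_inverse(1)[OF M, of "()"] by (cases "mat_inverse M") auto
  then show "the (mat_inverse M) \<in> carrier_mat n n" "M * the (mat_inverse M) = 1\<^sub>m n"
    using mat_inverse(2)[OF M] by auto
qed

text \<open>The lower bound on \<open>M\<close>, evaluated at \<open>D *\<^sub>v w\<close> with
  \<open>D\<close> the inverse, says that \<open>D\<close> has norm at most
  \<open>1 / a\<close>.\<close>

lemma cond_number_le:
  assumes M: "M \<in> carrier_mat n n" and n: "0 < n" and inv: "invertible_mat M"
    and upper: "\<And>v. v \<in> carrier_vec n \<Longrightarrow> vec_norm2 (M *\<^sub>v v) \<le> b * vec_norm2 v"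
    and lower: "\<And>v. v \<in> carrier_vec n \<Longrightarrow> a * vec_norm2 v \<le> vec_norm2 (M *\<^sub>v v)"
    and a: "0 < a"
  shows "cond_number M \<le> b / a"
proof -
  define D where "D = the (mat_inverse M)"
  have D: "D \<in> carrier_mat n n" "M * D = 1\<^sub>m n"
    using invertible_mat_inverse[OF M inv] by (simp_all add: D_def)
  have "spectral_norm D \<le> 1 / a"
  proof (rule spectral_norm_le)
    show "0 < dim_col D" using D n by simp
    fix w :: "real vec"
    assume "w \<in> carrier_vec (dim_col D)"
    then have w: "w \<in> carrier_vec n" using D by simp
    have "M *\<^sub>v (D *\<^sub>v w) = w"
      using assoc_mult_mat_vec[OF M D(1) w] D(2) w by simp
    then have "a * vec_norm2 (D *\<^sub>v w) \<le> vec_norm2 w"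
      using lower[of "D *\<^sub>v w"] D w by simp
    then show "vec_norm2 (D *\<^sub>v w) \<le> 1 / a * vec_norm2 w"
      using a by (simp add: field_simps)
  qed
  moreover have "spectral_norm M \<le> b"
    using M n upper by (intro spectral_norm_le) auto
  moreover have "0 \<le> spectral_norm M" "0 \<le> spectral_norm D"
    using M D n by (auto intro: spectral_norm_nonneg)
  ultimately have "spectral_norm M * spectral_norm D \<le> b * (1 / a)"
    by (intro mult_mono) auto
  then show ?thesis by (simp add: cond_number_def D_def)
qed

theorem proposition2p1:
  fixes N :: nat and d :: "nat \<Rightarrow> nat" and A :: "nat \<Rightarrow> real mat" and \<A> :: "real mat"
  assumes "N \<ge> 1"
    and "\<And>i. i \<in> {1..N} \<Longrightarrow> d i \<ge> 1"
    and "\<And>i. i \<in> {1..N} \<Longrightarrow> A i \<in> carrier_mat (d i) (d i)"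
    and "\<A> = 1\<^sub>m (\<Prod>i=1..N. d i) - kronecker_chain A N"
    and "invertible_mat \<A>"
    and "(\<Prod>i=1..N. sigma_min (A i)) > 1"
  shows "cond_number \<A> \<le>
    ((\<Prod>i=1..N. sigma_min (A i)) / ((\<Prod>i=1..N. sigma_min (A i)) - 1)) *
    (1 + (\<Prod>i=1..N. spectral_norm (A i)))"
proof -
  define n where "n = (\<Prod>i=1..N. d i)"
  define K where "K = kronecker_chain A N"
  define s where "s = (\<Prod>i=1..N. sigma_min (A i))"
  define t where "t = (\<Prod>i=1..N. spectral_norm (A i))"
  have s: "1 < s" using assms(6) by (simp add: s_def)
  have n: "0 < n" unfolding n_def using assms(2) by (intro prod_pos) force
  have K: "K \<in> carrier_mat n n"
    unfolding K_def n_def by (rule kronecker_chain_carrier[OF assms(3)])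
  have M: "\<A> \<in> carrier_mat n n" 
    unfolding assms(4) n_def[symmetric] K_def[symmetric] by (rule minus_carrier_mat[OF K])
  have mult: "\<A> *\<^sub>v v = v - K *\<^sub>v v" if "v \<in> carrier_vec n" for v
    using minus_mult_distrib_mat_vec[OF one_carrier_mat K that] that
    by (simp add: assms(4) n_def K_def)
  note bounds = kronecker_chain_mult_vec_bounds[where A = A and d = d and N = N, OF assms(2,3),
      folded n_def K_def s_def t_def]
  have "0 \<le> t" unfolding t_def
  proof (rule prod_nonneg)
    fix i assume "i \<in> {1..N}"
    then show "0 \<le> spectral_norm (A i)"
      using assms(2)[of i] assms(3)[of i] spectral_norm_nonneg[of "A i"] by auto
  qed
  \<comment> \<open>The argument yields this sharper bound; the factor \<open>s > 1\<close> of the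
    claim only enlarges it, because \<open>1 + t\<close> is nonnegative.\<close>
  have "cond_number \<A> \<le> (1 + t) / (s - 1)"
  proof (rule cond_number_le[OF M n assms(5)])
    fix v :: "real vec"
    assume v: "v \<in> carrier_vec n"
    have Kv: "K *\<^sub>v v \<in> carrier_vec n" using K v by simp
    show "vec_norm2 (\<A> *\<^sub>v v) \<le> (1 + t) * vec_norm2 v"
      using vec_norm2_diff_le[OF v Kv] bounds(2)[OF _ _ v] by (simp add: mult[OF v] distrib_right)
    show "(s - 1) * vec_norm2 v \<le> vec_norm2 (\<A> *\<^sub>v v)"
      using vec_norm2_diff_ge[OF v Kv] bounds(1)[OF _ _ v] by (simp add: mult[OF v] left_diff_distrib)
  qed (use s in simp)
  also have "\<dots> \<le> s * (1 + t) / (s - 1)"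
    using s \<open>0 \<le> t\<close> by (intro divide_right_mono) auto
  finally show ?thesis by (simp add: s_def t_def)
qed

end
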